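(* Let $\zeta\in\{0,\infty\}$, and let $V\in L^\infty_{\mathrm{loc}}(\Omega\setminus\{\zeta\})$. Suppose that near $\zeta$ one has $|V(x)|\le g(|x|)/|x|^p$, where $g:\mathbb{R}_+\to\mathbb{R}_+$ is a positive, bounded and continuous function which satisfies either $$\left|\int_\zeta^1\left|t^{1-d}\int_a^t\frac{g(s)}{s^p}s^{d-1}\,ds\right|^{\frac1{p-1}}dt\right|<\infty,$$ where $a=\zeta$ in the classical cases and $a=1$ in the nonclassical cases, or $$\left|\int_\zeta^1\frac{g(s)}{s}\,ds\right|<\infty\ \text{ if } p\ne d,\qquad \left|\int_\zeta^1\frac{g(s)}{s}|\log s|^{d-1}\,ds\right|<\infty\ \text{ if } p=d.$$ Then $V$ has a weak Fuchsian singularity at $\zeta$. Moreover, $$R^pV(Rx)\underset{R\to\zeta}{\longrightarrow}0\quad\text{in the weak}^*\text{ topology of }L^\infty_{\mathrm{loc}}(\mathbb{R}^d\setminus\{0\}).$$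
   Context: Setting: $1<p<\infty$, $d\ge2$ an integer, $B_R\subset\mathbb{R}^d$ the open ball of radius $R$ centered at $0$, $B_R^*:=\mathbb{R}^d\setminus\overline{B_R}$. Either $\zeta=0$ and $\Omega=B_{R_0}$, or $\zeta=\infty$ and $\Omega=B_{R_0}^*$, for some $R_0>0$; $V$ is real valued. Classical cases: $\zeta=0$ with $p\le d$, and $\zeta=\infty$ with $p\ge d$. Nonclassical cases: $\zeta=0$ with $p>d$, and $\zeta=\infty$ with $p<d$. Scaled potentials: $V_R(x):=R^pV(Rx)$ for $x\in\Omega/R$. For a sequence $R_n>0$ with $R_n\to\zeta$, $V_{R_n}\to W$ weak$^*$ in $L^\infty_{\mathrm{loc}}(\mathbb{R}^d\setminus\{0\})$ means $\int V_{R_n}\varphi\,dx\to\int W\varphi\,dx$ for every $\varphi\in L^1$ with compact support in $\mathbb{R}^d\setminus\{0\}$ (every such compact set lies in $\Omega/R_n$ for large $n$); then $W$ is called the limiting dilated potential of $V$ with respect to $\{R_n\}$. Weak Fuchsian singularity at $\zeta$: there is $C>0$ with $|x|^p|V(x)|\le C$ near $\zeta$, and there exist $m\ge1$ and sequences $\{R_n^{(i)}\}_{n}\subset\mathbb{R}_+$, $1\le i\le m$, with $R_n^{(i)}\to\zeta^{(i)}$, $\zeta^{(1)}=\zeta$, $\zeta^{(i)}\in\{0,\infty\}$ for $2\le i\le m$, such that taking successively limiting dilated potentials $W_0:=V$, $W_i:=$ weak$^*$ limit of $(R_n^{(i)})^pW_{i-1}(R_n^{(i)}x)$ as $n\to\infty$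 (all these limits existing on $\mathbb{R}^d\setminus\{0\}$), one ends with $W_m=0$. *)

theory Defs
  imports "HOL-Analysis.Analysis"
begin

text \<open>
  The singular point is \<open>\<zeta> \<in> {0, \<infinity>}\<close>, represented in \<^typ>\<open>ereal\<close>; the definitions
  below are meant for these two values only. The punctured domain \<open>\<Omega> \<setminus> {\<zeta>}\<close> is
  \<open>sing_domain \<zeta> R\<^sub>0 - {0}\<close> in both cases, as \<open>0 \<notin> \<Omega>\<close> when \<open>\<zeta> = \<infinity>\<close>.
\<close>

definition sing_domain :: "ereal \<Rightarrow> real \<Rightarrow> 'a::euclidean_space set" where
  "sing_domain \<zeta> R\<^sub>0 = (if \<zeta> = 0 then ball 0 R\<^sub>0 else - cball 0 R\<^sub>0)"

definition radii_to :: "ereal \<Rightarrow> real filter" where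
  "radii_to \<zeta> = (if \<zeta> = 0 then at_right 0 else at_top)"

definition ae_near :: "ereal \<Rightarrow> ('a::euclidean_space \<Rightarrow> bool) \<Rightarrow> bool" where
  "ae_near \<zeta> P \<longleftrightarrow>
     (\<exists>r>0. AE x in lebesgue. (if \<zeta> = 0 then 0 < norm x \<and> norm x < r else r < norm x) \<longrightarrow> P x)"

definition Linf_loc :: "'a::euclidean_space set \<Rightarrow> ('a \<Rightarrow> real) set" where
  "Linf_loc U = {f. f \<in> borel_measurable (lebesgue_on U) \<and>
     (\<forall>K. compact K \<and> K \<subseteq> U \<longrightarrow> (\<exists>C. AE x in lebesgue. x \<in> K \<longrightarrow> \<bar>f x\<bar> \<le> C))}"

definition dilate :: "real \<Rightarrow> ('a::euclidean_space \<Rightarrow> real) \<Rightarrow> real \<Rightarrow> 'a \<Rightarrow> real" where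
  "dilate p V R x = R powr p * V (R *\<^sub>R x)"

text \<open>
  Weak* convergence in \<open>L\<^sup>\<infinity>\<^sub>l\<^sub>o\<^sub>c\<close> of the space punctured at the origin. The functions \<open>U i\<close> are
  total, but may be meaningful only on part of the space (as \<open>dilate p V R\<close> is on \<open>\<Omega> / R\<close>):
  it suffices that each compact \<open>K\<close> is eventually contained in the meaningful part, since only
  the eventual behaviour of the integrals matters.
\<close>
definition weak_star_loc ::
    "('i \<Rightarrow> 'a::euclidean_space \<Rightarrow> real) \<Rightarrow> ('a \<Rightarrow> real) \<Rightarrow> 'i filter \<Rightarrow> bool" where
  "weak_star_loc U W F \<longleftrightarrow> W \<in> Linf_loc (- {0}) \<and>
     (\<forall>\<phi> K. integrable lebesgue \<phi> \<and> compact K \<and> 0 \<notin> K \<and> (\<forall>x. x \<notin> K \<longrightarrow> \<phi> x = 0) \<longrightarrow>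
        ((\<lambda>i. LINT x|lebesgue. U i x * \<phi> x) \<longlongrightarrow> (LINT x|lebesgue. W x * \<phi> x)) F)"

definition limiting_dilated_potential ::
    "real \<Rightarrow> ('a::euclidean_space \<Rightarrow> real) \<Rightarrow> (nat \<Rightarrow> real) \<Rightarrow> ('a \<Rightarrow> real) \<Rightarrow> bool" where
  "limiting_dilated_potential p V R W \<longleftrightarrow> weak_star_loc (\<lambda>n. dilate p V (R n)) W sequentially"

text \<open>
  As everywhere here, \<open>V\<close> is understood to be in \<open>L\<^sup>\<infinity>\<^sub>l\<^sub>o\<^sub>c\<close> of the punctured domain. \<open>W\<close> ranges over
  representatives, so the last limit vanishes almost everywhere.
\<close>
definition weak_fuchsian :: "real \<Rightarrow> ereal \<Rightarrow> ('a::euclidean_space \<Rightarrow> real) \<Rightarrow> bool" where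
  "weak_fuchsian p \<zeta> V \<longleftrightarrow>
     (\<exists>C>0. ae_near \<zeta> (\<lambda>x. norm x powr p * \<bar>V x\<bar> \<le> C)) \<and>
     (\<exists>(m::nat) (Z :: nat \<Rightarrow> ereal) (R :: nat \<Rightarrow> nat \<Rightarrow> real) (W :: nat \<Rightarrow> 'a \<Rightarrow> real).
        1 \<le> m \<and> Z 1 = \<zeta> \<and> (\<forall>i\<in>{2..m}. Z i \<in> {0, \<infinity>}) \<and>
        (\<forall>i\<in>{1..m}. (\<forall>n. 0 < R i n) \<and> filterlim (R i) (radii_to (Z i)) sequentially) \<and>
        W 0 = V \<and>
        (\<forall>i\<in>{1..m}. limiting_dilated_potential p (W (i - 1)) (R i) (W i)) \<and>
        (AE x in lebesgue. W m x = 0))"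

definition classical_case :: "real \<Rightarrow> nat \<Rightarrow> ereal \<Rightarrow> bool" where
  "classical_case p d \<zeta> \<longleftrightarrow> \<zeta> = 0 \<and> p \<le> real d \<or> \<zeta> = \<infinity> \<and> real d \<le> p"

definition base_point :: "real \<Rightarrow> nat \<Rightarrow> ereal \<Rightarrow> ereal" where
  "base_point p d \<zeta> = (if classical_case p d \<zeta> then \<zeta> else 1)"

text \<open>
  For a nonnegative integrand, finiteness of the integral from \<open>\<zeta>\<close> to \<open>1\<close> is integrability on
  the interval. In the nested condition the inner integral may diverge when \<open>a = \<zeta>\<close>; the
  outer one is then infinite. The Bochner integral would return \<open>0\<close> for it, so convergence
  of the inner integral is required explicitly.
\<close>
definition nested_integral_condition :: "real \<Rightarrow> nat \<Rightarrow> ereal \<Rightarrow> (real \<Rightarrow> real) \<Rightarrow> bool" where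
  "nested_integral_condition p d \<zeta> g \<longleftrightarrow>
     (let a = base_point p d \<zeta>; h = (\<lambda>s. g s / s powr p * s ^ (d - 1)) in
        (\<forall>t. ereal t \<in> {min \<zeta> 1<..<max \<zeta> 1} \<longrightarrow> interval_lebesgue_integrable lborel a (ereal t) h) \<and>
        interval_lebesgue_integrable lborel \<zeta> 1
          (\<lambda>t. \<bar>t powr (1 - real d) * (LBINT s=a..ereal t. h s)\<bar> powr (1 / (p - 1))))"

definition simple_integral_condition :: "real \<Rightarrow> nat \<Rightarrow> ereal \<Rightarrow> (real \<Rightarrow> real) \<Rightarrow> bool" where
  "simple_integral_condition p d \<zeta> g \<longleftrightarrow>
     (if p \<noteq> real d then interval_lebesgue_integrable lborel \<zeta> 1 (\<lambda>s. g s / s)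
      else interval_lebesgue_integrable lborel \<zeta> 1 (\<lambda>s. g s / s * \<bar>ln s\<bar> ^ (d - 1)))"

end

theory Submission
  imports Defs
begin

text \<open>
  Since \<open>|R\<^sup>p V(R x)| \<le> g(R |x|) / |x|\<^sup>p\<close> with \<open>g\<close> bounded, truncating the test function reduces the
  weak* convergence to \<open>\<integral> g(R |x|) dx \<rightarrow> 0\<close> over annuli \<open>a \<le> |x| \<le> b\<close>, which in polar coordinates is
  \<open>I(R) = \<integral> g(s) / s ds \<rightarrow> 0\<close> over the windows \<open>[R a, R b]\<close>. The simple condition gives this at once,
  as the windows escape to \<open>\<zeta>\<close>. Under the nested condition, the outer integrand on a suitable
  neighbouring window is at least a constant times \<open>I(R) powr (1 / (p - 1)) / R\<close>, and its integral over that
  window tends to \<open>0\<close>. A single limiting dilated potential then already vanishes.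
\<close>

section \<open>Polar coordinates for radial functions\<close>

text \<open>Both measures give \<open>{..a}\<close> the volume of the ball of radius
  \<open>a\<close>, the density being the derivative of that volume in the radius. These half-lines
  are stable under intersection, generate the Borel sets, and countably many of them of finite
  measure exhaust the line.\<close>

lemma distr_norm_lborel:
  "distr lborel borel (norm :: 'a::euclidean_space \<Rightarrow> real) =
     density lborel (\<lambda>r. ennreal (indicator {0..} r * (unit_ball_vol DIM('a) * DIM('a) * r ^ (DIM('a) - 1))))"
    (is "?M = density lborel (\<lambda>r. ennreal (?w r))")
proof (rule measure_eqI_generator_eq[where E = "range (\<lambda>a. {..a})" and \<Omega> = UNIV
      and A = "\<lambda>n::nat. {..real n}"])
  have M: "emeasure ?M {..a} = (if a < 0 then 0 else ennreal (unit_ball_vol DIM('a) * a ^ DIM('a)))" for a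
  proof -
    have "emeasure ?M {..a} = emeasure lborel (norm -` {..a} \<inter> space lborel :: 'a set)"
      by (rule emeasure_distr) auto
    also have "norm -` {..a} \<inter> space lborel = (cball 0 a :: 'a set)"
      by (auto simp: dist_norm)
    finally show ?thesis
      by (auto simp: emeasure_cball)
  qed
  have N: "emeasure (density lborel (\<lambda>r. ennreal (?w r))) {..a} =
      (if a < 0 then 0 else ennreal (unit_ball_vol DIM('a) * a ^ DIM('a)))" for a
  proof (cases "a < 0")
    case True
    have "emeasure (density lborel (\<lambda>r. ennreal (?w r))) {..a} = (\<integral>\<^sup>+ r. 0 \<partial>(lborel :: real measure))"
      using True by (subst emeasure_density) (auto simp del: nn_integral_const intro!: nn_integral_cong split: split_indicator)
    then show ?thesis using True by simp
  next
    case False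
    let ?f = "\<lambda>r::real. unit_ball_vol DIM('a) * DIM('a) * r ^ (DIM('a) - 1)"
    have "emeasure (density lborel (\<lambda>r. ennreal (?w r))) {..a} =
        (\<integral>\<^sup>+ r. ennreal (?f r) * indicator {0..a} r \<partial>lborel)"
      by (subst emeasure_density) (auto intro!: nn_integral_cong split: split_indicator)
    also have "\<dots> = ennreal (unit_ball_vol DIM('a) * a ^ DIM('a) - unit_ball_vol DIM('a) * 0 ^ DIM('a))"
      using False
      by (intro nn_integral_FTC_Icc) (auto intro!: derivative_eq_intros)
    finally show ?thesis using False by simp
  qed
  show "emeasure ?M X = emeasure (density lborel (\<lambda>r. ennreal (?w r))) X"
    if "X \<in> range (\<lambda>a. {..a})" for X
    using that M N by auto
  show "emeasure ?M {..real n} \<noteq> \<infinity>" for n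
    using M by simp
  show "Int_stable (range (\<lambda>a::real. {..a}))"
    by (auto simp: Int_stable_def)
  show "sets ?M = sigma_sets UNIV (range (\<lambda>a. {..a}))"
    "sets (density lborel (\<lambda>r. ennreal (?w r))) = sigma_sets UNIV (range (\<lambda>a. {..a}))"
    by (simp_all add: borel_eq_atMost)
qed (auto intro: real_arch_simple)

lemma integral_norm_lborel:
  fixes f :: "real \<Rightarrow> real"
  assumes [measurable]: "f \<in> borel_measurable borel"
  shows "(LINT x|lborel. f (norm (x :: 'a::euclidean_space))) =
     unit_ball_vol DIM('a) * DIM('a) * (LINT r:{0..}|lborel. r ^ (DIM('a) - 1) * f r)"
    and "integrable lborel (\<lambda>x::'a. f (norm x)) \<longleftrightarrow>
      set_integrable lborel {0..} (\<lambda>r. r ^ (DIM('a) - 1) * f r)"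
proof -
  let ?c = "unit_ball_vol DIM('a) * DIM('a)"
  let ?w = "\<lambda>r. indicator {0..} r * (?c * r ^ (DIM('a) - 1))"
  \<comment> \<open>The equivalence of the two integrability claims cancels this factor, so it must
    not vanish.\<close>
  have nz: "?c \<noteq> 0" using unit_ball_vol_pos[of "real DIM('a)"] by (simp del: unit_ball_vol_pos)
  have nn: "AE r in lborel. 0 \<le> ?w r" by (auto split: split_indicator)
  have eq: "?w r *\<^sub>R f r = ?c * (indicator {0..} r *\<^sub>R (r ^ (DIM('a) - 1) * f r))" for r
    by simp
  have "(LINT x|lborel. f (norm (x :: 'a))) = (LINT r|density lborel ?w. f r)"
    unfolding distr_norm_lborel[symmetric] by (rule integral_distr[symmetric]) auto
  also have "\<dots> = (LINT r|lborel. ?w r *\<^sub>R f r)"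
    by (rule integral_density) (use nn in auto)
  finally show "(LINT x|lborel. f (norm (x :: 'a))) = ?c * (LINT r:{0..}|lborel. r ^ (DIM('a) - 1) * f r)"
    unfolding eq set_lebesgue_integral_def by simp
  have "integrable lborel (\<lambda>x::'a. f (norm x)) \<longleftrightarrow> integrable (density lborel ?w) f"
    unfolding distr_norm_lborel[symmetric] by (rule integrable_distr_eq[symmetric]) auto
  also have "\<dots> \<longleftrightarrow> integrable lborel (\<lambda>r. ?w r *\<^sub>R f r)"
    by (rule integrable_density) (use nn in auto)
  finally show "integrable lborel (\<lambda>x::'a. f (norm x)) \<longleftrightarrow>
      set_integrable lborel {0..} (\<lambda>r. r ^ (DIM('a) - 1) * f r)"
    unfolding eq set_integrable_def using nz by simp
qed

section \<open>Dilations, and radii tending to the singular point\<close>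

text \<open>The new exceptional set lies in the image of the old one under the linear map
  \<open>x / c\<close>, and a differentiable map of the space into itself preserves
  negligibility.\<close>

lemma AE_lebesgue_scaleR:
  fixes P :: "'a::euclidean_space \<Rightarrow> bool"
  assumes "AE x in lebesgue. P x" "c \<noteq> 0"
  shows "AE x in lebesgue. P (c *\<^sub>R x)"
proof -
  have "negligible {x. \<not> P x}"
    using assms(1) unfolding eventually_ae_filter
    by (auto simp flip: negligible_iff_null_sets intro: negligible_subset)
  then have "negligible ((\<lambda>x. inverse c *\<^sub>R x) ` {x. \<not> P x})"
    by (intro negligible_differentiable_image_negligible) (auto intro!: derivative_intros)
  moreover have "{x. \<not> P (c *\<^sub>R x)} \<subseteq> (\<lambda>x. inverse c *\<^sub>R x) ` {x. \<not> P x}"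
    using assms(2) by (auto intro!: image_eqI[where x = "c *\<^sub>R _"])
  ultimately show ?thesis
    by (auto simp: negligible_iff_null_sets intro: AE_I')
qed

text \<open>Both filters are determined by their sequences. This gives access to dominated
  convergence, which is a statement about sequences.\<close>

lemma tendsto_radii_toI_sequentially:
  fixes f :: "real \<Rightarrow> 'b::first_countable_topology"
  assumes "\<And>X. filterlim X (radii_to \<zeta>) sequentially \<Longrightarrow> (\<lambda>n. f (X n)) \<longlonglongrightarrow> y"
  shows "(f \<longlongrightarrow> y) (radii_to \<zeta>)"
proof (cases "\<zeta> = 0")
  case True
  have "(f \<longlongrightarrow> y) (at_right 0)"
    unfolding tendsto_at_iff_sequentially o_def
    using assms True by (simp add: radii_to_def filterlim_at less_imp_neq[THEN not_sym])
  then show ?thesis using True by (simp add: radii_to_def)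
next
  case False
  then show ?thesis
    using assms unfolding radii_to_def by (auto intro: tendsto_at_topI_sequentially)
qed

lemma eventually_radii_to_pos: "eventually (\<lambda>R. 0 < R) (radii_to \<zeta>)"
  by (auto simp: radii_to_def eventually_at_right_less eventually_gt_at_top)

text \<open>The precise sense in which windows escape to \<zeta>: whether \<open>[R a, R b]\<close>
  lies beyond a threshold \<open>c\<close> is decided by its end point on the side away from
  \<zeta>.\<close>

lemma eventually_radii_to_window:
  assumes "\<zeta> \<in> {0, \<infinity>}" "0 < a"  "a \<le> b" "0 < c"
  shows "\<forall>\<^sub>F R in radii_to \<zeta>. 0 < R \<and> (if \<zeta> = 0 then R * b < c else c < R * a)"
proof (cases "\<zeta> = 0")
  case True
  have "\<forall>\<^sub>F R in at_right 0. R \<in> {0<..<c/b}"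
    using assms by (intro eventually_at_right_real) auto
  then show ?thesis unfolding radii_to_def using True assms
    by (auto elim!: eventually_mono simp: field_simps)
next
  case False
  have "\<forall>\<^sub>F R in at_top. 0 < R \<and> c / a < R"
    by (intro eventually_conj eventually_gt_at_top)
  then show ?thesis unfolding radii_to_def using False assms
    by (auto elim!: eventually_mono simp: pos_divide_less_eq)
qed

section \<open>Integrals over windows escaping to the singular point\<close>

text \<open>Dominated convergence: every fixed \<open>s\<close> is eventually outside the window, so
  the truncated integrands tend to zero pointwise, and they are dominated by
  \<open>\<bar>f\<bar>\<close> on the interval between \<zeta> and 1.\<close>

lemma window_integral_tendsto_0:
  fixes f :: "real \<Rightarrow> real"
  assumes \<zeta>: "\<zeta> \<in> {0, \<infinity>}" and ab: "0 < a" "a \<le> b"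
    and f: "set_integrable lborel (einterval (min \<zeta> 1) (max \<zeta> 1)) f"
  shows "((\<lambda>R. LINT s:{R * a..R * b}|lborel. f s) \<longlongrightarrow> 0) (radii_to \<zeta>)"
proof (rule tendsto_radii_toI_sequentially)
  fix X assume X: "filterlim X (radii_to \<zeta>) sequentially"
  let ?E = "einterval (min \<zeta> 1) (max \<zeta> 1)"
  \<comment> \<open>Nothing is known about \<open>f\<close> off the interval; the extension by zero
    is measurable and integrable on the whole line.\<close>
  define f' where "f' = (\<lambda>s. indicator ?E s *\<^sub>R f s)"
  have [measurable]: "f' \<in> borel_measurable borel"
    using f unfolding set_integrable_def f'_def by (simp add: borel_measurable_integrable)
  have ev: "\<forall>\<^sub>F n in sequentially. 0 < X n \<and> (if \<zeta> = 0 then X n * b < c else c < X n * a)" if "0 < c" for c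
    using eventually_radii_to_window[OF \<zeta> ab that] X unfolding filterlim_iff by blast
  have "(\<lambda>n. LINT s|lborel. indicator {X n * a..X n * b} s *\<^sub>R f' s) \<longlonglongrightarrow> integral\<^sup>L lborel (\<lambda>s::real. 0::real)"
  proof (rule integral_dominated_convergence[where w = "\<lambda>s. norm (f' s)"])
    show "integrable lborel (\<lambda>s. norm (f' s))"
      using f unfolding set_integrable_def f'_def by (rule integrable_norm)
    show "AE s in lborel. (\<lambda>n. indicator {X n * a..X n * b} s *\<^sub>R f' s) \<longlonglongrightarrow> 0"
    proof (rule AE_I2)
      fix s :: real
      have "\<forall>\<^sub>F n in sequentially. indicator {X n * a..X n * b} s *\<^sub>R f' s = 0"
      proof (cases "0 < s")
        case True
        from ev[OF this] show ?thesis
          by (rule eventually_mono) (auto split: split_indicator if_splits)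
      next
        case False
        from ev[OF zero_less_one] show ?thesis
        proof (rule eventually_mono)
          fix n assume "0 < X n \<and> (if \<zeta> = 0 then X n * b < 1 else 1 < X n * a)"
          with ab have "0 < X n * a" by simp
          with False show "indicator {X n * a..X n * b} s *\<^sub>R f' s = 0"
            by (auto split: split_indicator)
        qed
      qed
      then show "(\<lambda>n. indicator {X n * a..X n * b} s *\<^sub>R f' s) \<longlonglongrightarrow> 0"
        by (rule tendsto_eventually)
    qed
  qed (auto split: split_indicator)
  \<comment> \<open>Once the window has passed 1 it lies inside the interval, where
    \<open>f'\<close> and \<open>f\<close> agree.\<close>
  moreover have "\<forall>\<^sub>F n in sequentially. (LINT s|lborel. indicator {X n * a..X n * b} s *\<^sub>R f' s) =
      (LINT s:{X n * a..X n * b}|lborel. f s)"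
    using ev[OF zero_less_one]
  proof eventually_elim
    case (elim n)
    have "{X n * a..X n * b} \<subseteq> ?E"
      using elim \<zeta> less_le_trans[OF mult_pos_pos[OF conjunct1[OF elim] ab(1)]]
      by (auto simp: einterval_iff max_def min_def zero_ereal_def one_ereal_def split: if_splits)
    then show ?case
      unfolding set_lebesgue_integral_def f'_def by (intro Bochner_Integration.integral_cong) (auto split: split_indicator)
  qed
  ultimately show "(\<lambda>n. LINT s:{X n * a..X n * b}|lborel. f s) \<longlonglongrightarrow> 0"
    by (simp add: Lim_transform_eventually)
qed

text \<open>Integrability ignores orientation, so \<zeta> may lie on either side of 1 without a case
  distinction.\<close>

lemma interval_lebesgue_integrable_iff_min_max:
  "interval_lebesgue_integrable lborel a b f \<longleftrightarrow> set_integrable lborel (einterval (min a b) (max a b)) f"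
  by (auto simp: interval_lebesgue_integrable_def min_def max_def)

text \<open>Reversing the orientation only flips the sign, which the absolute value in the nested
  condition discards.\<close>

lemma abs_interval_lebesgue_integral_min_max:
  fixes f :: "real \<Rightarrow> real"
  shows
  "\<bar>LBINT s=a..b. f s\<bar> = \<bar>LINT s:einterval (min a b) (max a b)|lborel. f s\<bar>"
  by (cases "a \<le> b") (auto simp: interval_lebesgue_integral_def min_def max_def)

lemma window_pos:
  fixes R a b s :: real
  assumes "0 < a" "0 < R" "s \<in> {R * a..R * b}"
  shows "0 < s"
  using less_le_trans[OF mult_pos_pos[OF assms(2,1)]] assms(3) by simp

lemma set_integrable_window:
  fixes f :: "real \<Rightarrow> real"
  assumes "continuous_on {0<..} f" "0 < a" "0 < R"
  shows "set_integrable lborel {R * a..R * b} f"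
proof (intro borel_integrable_atLeastAtMost' continuous_on_subset[OF assms(1)] subsetI)
  fix s assume "s \<in> {R * a..R * b}"
  from window_pos[OF assms(2,3) this] show "s \<in> {0<..}" by simp
qed

lemma window_integral_nonneg:
  fixes g :: "real \<Rightarrow> real"
  assumes "\<And>s. 0 < s \<Longrightarrow> 0 < g s" "0 < a" "0 < R"
  shows "0 \<le> (LINT s:{R * a..R * b}|lborel. g s / s)"
  unfolding set_lebesgue_integral_def
proof (rule integral_nonneg_AE, rule AE_I2)
  fix s
  show "0 \<le> indicator {R * a..R * b} s *\<^sub>R (g s / s)"
    using window_pos[OF assms(2,3), of s b] assms(1)[of s] by (auto split: split_indicator)
qed

lemma eventually_window_integral_nonneg:
  fixes g :: "real \<Rightarrow> real"
  assumes "\<And>s. 0 < s \<Longrightarrow> 0 < g s" "0 < a"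
  shows "\<forall>\<^sub>F R in radii_to \<zeta>. 0 \<le> (LINT s:{R * a..R * b}|lborel. g s / s)"
  using eventually_radii_to_pos
  by (rule eventually_mono) (use assms window_integral_nonneg[of g a _ b] in blast)

section \<open>Vanishing window integrals under either integral condition\<close>

text \<open>For \<open>p \<noteq> d\<close> the integrand is itself integrable up to \<zeta>. For
  \<open>p = d\<close> the logarithmic weight is at least 1 on windows near \<zeta>, so the weighted
  window integral is a majorant tending to zero.\<close>

lemma simple_condition_imp_window_integral_tendsto_0:
  fixes a b :: real and g :: "real \<Rightarrow> real"
  assumes \<zeta>: "\<zeta> \<in> {0, \<infinity>}" and ab: "0 < a" "a \<le> b"
    and g_cont: "continuous_on {0<..} g" and g_pos: "\<And>s. 0 < s \<Longrightarrow> 0 < g s"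
    and "simple_integral_condition p d \<zeta> g"
  shows "((\<lambda>R. LINT s:{R * a..R * b}|lborel. g s / s) \<longlongrightarrow> 0) (radii_to \<zeta>)"
proof (cases "p = real d")
  case False
  then show ?thesis
    using assms(6) \<zeta> ab by (intro window_integral_tendsto_0)
      (auto simp: simple_integral_condition_def interval_lebesgue_integrable_iff_min_max)
next
  case True
  let ?f = "\<lambda>s. g s / s * \<bar>ln s\<bar> ^ (d - 1)"
  have lim: "((\<lambda>R. LINT s:{R * a..R * b}|lborel. ?f s) \<longlongrightarrow> 0) (radii_to \<zeta>)"
    using assms(6) \<zeta> ab True by (intro window_integral_tendsto_0)
      (auto simp: simple_integral_condition_def interval_lebesgue_integrable_iff_min_max)
  \<comment> \<open>Past these thresholds \<open>\<bar>ln s\<bar>\<close> is at least 1: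
    \<open>exp (-1)\<close> serves \<zeta> = 0 and \<open>exp 1\<close> serves \<zeta> =
    \<infinity>.\<close>
  have "\<forall>\<^sub>F R in radii_to \<zeta>. 0 < R \<and> (if \<zeta> = 0 then R * b < exp (-1) else exp (-1) < R * a)"
    by (rule eventually_radii_to_window[OF \<zeta> ab]) simp
  moreover have "\<forall>\<^sub>F R in radii_to \<zeta>. 0 < R \<and> (if \<zeta> = 0 then R * b < exp 1 else exp 1 < R * a)"
    by (rule eventually_radii_to_window[OF \<zeta> ab]) simp
  ultimately have "\<forall>\<^sub>F R in radii_to \<zeta>. (LINT s:{R * a..R * b}|lborel. g s / s) \<le> (LINT s:{R * a..R * b}|lborel. ?f s)"
  proof eventually_elim
    case (elim R)
    show ?case
    proof (rule set_integral_mono)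
      show "set_integrable lborel {R * a..R * b} (\<lambda>s. g s / s)" "set_integrable lborel {R * a..R * b} ?f"
        using elim by (auto intro!: set_integrable_window continuous_intros g_cont ab)
      fix s assume s: "s \<in> {R * a..R * b}"
      then have "0 < s" using elim window_pos[OF ab(1)] by blast
      have "1 \<le> \<bar>ln s\<bar>"
      proof (cases "\<zeta> = 0")
        case True
        with elim s have "s < exp (-1)" by auto
        with \<open>0 < s\<close> have "ln s < -1" by (metis ln_exp ln_less_cancel_iff exp_gt_zero)
        then show ?thesis by simp
      next
        case False
        with elim s have "exp 1 < s" by auto
        with \<open>0 < s\<close> have "1 < ln s" by (metis ln_exp ln_less_cancel_iff exp_gt_zero)
        then show ?thesis by simp
      qed
      then have "1 \<le> \<bar>ln s\<bar> ^ (d - 1)" by (rule one_le_power)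
      then show "g s / s \<le> ?f s"
        using mult_left_mono[of 1 "\<bar>ln s\<bar> ^ (d - 1)" "g s / s"] g_pos[OF \<open>0 < s\<close>] \<open>0 < s\<close> by simp
    qed
  qed
  from tendsto_sandwich[OF _ this tendsto_const lim] show ?thesis
    using eventually_window_integral_nonneg[of g a b \<zeta>] g_pos ab by blast
qed

text \<open>The outer integrand is integrable, so its window integrals vanish. They control those of
  \<open>g s / s\<close> because the powers of the scale balance: \<open>h\<close> contributes
  \<open>R powr (d - p)\<close> and the outer weight \<open>R powr (1 - d)\<close>, together
  \<open>R powr (1 - p)\<close>; the exponent \<open>1 / (p - 1)\<close> turns this into
  \<open>1 / R\<close>, which the length of the auxiliary window cancels.\<close>

lemma nested_condition_imp_window_integral_tendsto_0:
  fixes a b :: real and g :: "real \<Rightarrow> real"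
  assumes \<zeta>: "\<zeta> \<in> {0, \<infinity>}" and ab: "0 < a" "a \<le> b"
    and g_cont: "continuous_on {0<..} g" and g_pos: "\<And>s. 0 < s \<Longrightarrow> 0 < g s"
    and p: "1 < p" and d: "1 \<le> d" and nested: "nested_integral_condition p d \<zeta> g"
  shows "((\<lambda>R. LINT s:{R * a..R * b}|lborel. g s / s) \<longlongrightarrow> 0) (radii_to \<zeta>)"
proof -
  define e where "e = base_point p d \<zeta>"
  define h where "h = (\<lambda>s. g s / s powr p * s ^ (d - 1))"
  define G where "G = (\<lambda>t. \<bar>t powr (1 - real d) * (LBINT s=e..ereal t. h s)\<bar> powr (1 / (p - 1)))"
  \<comment> \<open>For \<open>t\<close> in the auxiliary window \<open>[R v, R w]\<close>, chosen on the far side of \<open>[R a, R b]\<close> from the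
    base point \<open>e\<close>, the inner integral runs over all of \<open>[R a, R b]\<close>.\<close>
  define up where "up \<longleftrightarrow> \<zeta> = 0 \<and> p \<le> d \<or> \<zeta> = \<infinity> \<and> p < d"
  define v where "v = (if up then 2 * b else a / 3)"
  define w where "w = (if up then 3 * b else a / 2)"
  \<comment> \<open>\<open>m\<close> is the least value of \<open>u powr (d - p)\<close> on
    \<open>[a, b]\<close>, attained at an end point that depends on the sign of
    \<open>d - p\<close>. In \<open>c\<close> it is joined with the least value of the outer weight,
    attained at the right end \<open>w\<close>.\<close>
  define m where "m = min (a powr (real d - p)) (b powr (real d - p))"
  define c where "c = w powr (1 - real d) * m"
  let ?I = "\<lambda>R. LINT s:{R * a..R * b}|lborel. g s / s"
  have vw: "0 < v" "v < w" using ab by (auto simp: v_def w_def)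
  \<comment> \<open>The interval \<open>[a/3, 3b]\<close> contains both \<open>[a, b]\<close> and
    \<open>[v, w]\<close>, so a single threshold moves both windows past 1.\<close>
  have window: "0 < a / 3" "a / 3 \<le> 3 * b" using ab by auto
  have m: "0 < m" using ab by (auto simp: m_def)
  have c: "0 < c" using m vw by (auto simp: c_def)
  \<comment> \<open>For windows near \<zeta>, the base point lies below them exactly when
    \<open>up\<close> holds: classical at 0 or nonclassical at \<infinity>. In the other two cases
    it lies above them.\<close>
  have e: "e = (if up then if \<zeta> = 0 then 0 else 1 else if \<zeta> = 0 then 1 else \<infinity>)"
    using \<zeta> by (auto simp: e_def base_point_def classical_case_def up_def)
  have inner: "set_integrable lborel (einterval (min e (ereal t)) (max e (ereal t))) h"
    if "ereal t \<in> {min \<zeta> 1<..<max \<zeta> 1}" for t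
    using nested that unfolding nested_integral_condition_def Let_def e_def[symmetric] h_def[symmetric]
    by (simp add: interval_lebesgue_integrable_iff_min_max)
  have G: "set_integrable lborel (einterval (min \<zeta> 1) (max \<zeta> 1)) G"
    using nested unfolding nested_integral_condition_def Let_def e_def[symmetric] h_def[symmetric] G_def[symmetric]
    by (simp add: interval_lebesgue_integrable_iff_min_max)
  have lim: "((\<lambda>R. LINT t:{R * v..R * w}|lborel. G t) \<longlongrightarrow> 0) (radii_to \<zeta>)"
    using vw by (intro window_integral_tendsto_0[OF \<zeta> _ _ G]) auto
  have h_ge: "m * R powr (real d - p) * (g s / s) \<le> h s" if "0 < R" "s \<in> {R * a..R * b}" for R s
  proof -
    \<comment> \<open>Rescaling to \<open>u\<close> in \<open>[a, b]\<close> splits off the factor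
      \<open>R powr (d - p)\<close> and leaves a monotone power of \<open>u\<close>.\<close>
    define u where "u = s / R"
    have u: "a \<le> u" "u \<le> b" "s = R * u" using that by (auto simp: u_def field_simps)
    then have "0 < u" "0 < s" using ab that by auto
    have "m \<le> u powr (real d - p)"
      using u ab \<open>0 < u\<close> by (cases "p \<le> d")
        (auto simp: m_def min_le_iff_disj intro: powr_mono2 powr_mono2')
    then have "m * R powr (real d - p) \<le> s powr (real d - p)"
      using u that \<open>0 < u\<close> by (simp add: powr_mult mult.commute mult_left_mono)
    \<comment> \<open>The natural-number exponent \<open>d - 1\<close> agrees with the real one
      because \<open>1 \<le> d\<close>.\<close>
    moreover have "h s = s powr (real d - p) * (g s / s)"
      using \<open>0 < s\<close> d by (simp add: h_def powr_diff powr_realpow[symmetric] of_nat_diff field_simps)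
    ultimately show ?thesis
      using g_pos[OF \<open>0 < s\<close>] \<open>0 < s\<close> by (simp add: divide_right_mono mult_right_mono)
  qed
  \<comment> \<open>\<open>G t \<ge> (c I(R)) powr (1 / (p - 1)) / R\<close> on the auxiliary window, whose length is \<open>R (w - v)\<close>.\<close>
  have ev: "\<forall>\<^sub>F R in radii_to \<zeta>. ?I R \<le> ((LINT t:{R * v..R * w}|lborel. G t) / (w - v)) powr (p - 1) / c"
    using eventually_radii_to_window[OF \<zeta> window zero_less_one]
  proof eventually_elim
    case (elim R)
    let ?K = "(c * R powr (1 - p) * ?I R) powr (1 / (p - 1))"
    define A B where "A = R * a" and "B = R * b"
    from elim ab have R: "0 < R" and AB: "0 < A" "A \<le> B" by (auto simp: A_def B_def)
    have vw': "R * v = (if up then 2 * B else A / 3)" "R * w = (if up then 3 * B else A / 2)"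
      by (auto simp: v_def w_def A_def B_def)
    have small: "if \<zeta> = 0 then 3 * B < 1 else 3 < A"
      using elim by (auto simp: A_def B_def)
    have I0: "0 \<le> ?I R" using window_integral_nonneg[of g a R b] g_pos ab R by blast
    have sub: "{R * v..R * w} \<subseteq> einterval (min \<zeta> 1) (max \<zeta> 1)"
      unfolding vw' using small \<zeta> AB by (auto simp: einterval_iff max_def min_def zero_ereal_def one_ereal_def split: if_splits)
    have "?K \<le> G t" if t: "t \<in> {R * v..R * w}" for t
    proof -
      let ?E = "einterval (min e (ereal t)) (max e (ereal t))"
      have "0 < t" using t less_le_trans[OF mult_pos_pos[OF R vw(1)]] by auto
      have t': "ereal t \<in> {min \<zeta> 1<..<max \<zeta> 1}"
        using sub t by (auto simp: einterval_iff)
      \<comment> \<open>Here the placement of the auxiliary window enters: \<open>[R a, R b]\<close>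
        lies between \<open>e\<close> and \<open>t\<close>. Positivity of \<open>?E\<close> makes
        \<open>h\<close> nonnegative there, so restricting to the window can only decrease the
        integral.\<close>
      have E: "{R * a..R * b} \<subseteq> ?E" "?E \<subseteq> {0<..}"
        unfolding A_def[symmetric] B_def[symmetric] using t[unfolded vw'] small \<zeta> AB \<open>0 < t\<close>
        by (auto simp: e einterval_iff max_def min_def zero_ereal_def one_ereal_def split: if_splits)
      have hE: "0 \<le> h s" if "s \<in> ?E" for s
        using E(2) that g_pos[of s] by (auto simp: h_def)
      have h_int: "set_integrable lborel {R * a..R * b} h"
        using inner[OF t'] _ E(1) by (rule set_integrable_subset) simp
      have "m * R powr (real d - p) * ?I R = (LINT s:{R * a..R * b}|lborel. m * R powr (real d - p) * (g s / s))"
        by (rule set_integral_mult_right[symmetric])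
      also have "\<dots> \<le> (LINT s:{R * a..R * b}|lborel. h s)"
      proof (rule set_integral_mono)
        show "set_integrable lborel {R * a..R * b} (\<lambda>s. m * R powr (real d - p) * (g s / s))"
          by (intro set_integrable_window R ab continuous_intros g_cont) auto
      qed (use h_int h_ge[OF R] in auto)
      also have "\<dots> \<le> (LINT s:?E|lborel. h s)"
        using inner[OF t'] h_int E(1) hE unfolding set_lebesgue_integral_def set_integrable_def
        by (intro integral_mono) (auto simp del: atLeastAtMost_iff split: split_indicator)
      also have "\<dots> \<le> \<bar>LBINT s=e..ereal t. h s\<bar>"
        unfolding abs_interval_lebesgue_integral_min_max by simp
      finally have 1: "m * R powr (real d - p) * ?I R \<le> \<bar>LBINT s=e..ereal t. h s\<bar>" .
      have 2: "(R * w) powr (1 - real d) \<le> t powr (1 - real d)"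
        using t \<open>0 < t\<close> d by (intro powr_mono2') auto
      have "c * R powr (1 - p) * ?I R = (R * w) powr (1 - real d) * (m * R powr (real d - p) * ?I R)"
        using R vw by (simp add: c_def powr_mult powr_add[symmetric] algebra_simps flip: powr_add)
      also have "\<dots> \<le> t powr (1 - real d) * \<bar>LBINT s=e..ereal t. h s\<bar>"
        using 1 2 m I0 by (intro mult_mono) auto
      also have "\<dots> = \<bar>t powr (1 - real d) * (LBINT s=e..ereal t. h s)\<bar>"
        by (simp add: abs_mult)
      finally show ?thesis
        unfolding G_def using c I0 p by (intro powr_mono2) auto
    qed
    then have K_le: "(LINT t:{R * v..R * w}|lborel. ?K) \<le> (LINT t:{R * v..R * w}|lborel. G t)"
      using set_integrable_subset[OF G _ sub]
      by (intro set_integral_mono borel_integrable_atLeastAtMost'[OF continuous_on_const]) auto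
    have "?K = (R powr (1 - p) * (c * ?I R)) powr (1 / (p - 1))"
      by (simp add: ac_simps)
    also have "\<dots> = R powr ((1 - p) * (1 / (p - 1))) * (c * ?I R) powr (1 / (p - 1))"
      using c I0 by (subst powr_mult) (auto simp: powr_powr)
    also have "(1 - p) * (1 / (p - 1)) = -1"
      using p by (simp add: field_simps)
    finally have "(c * ?I R) powr (1 / (p - 1)) = R * ?K"
      using R by (simp add: powr_minus)
    then have "(w - v) * (c * ?I R) powr (1 / (p - 1)) = (R * w - R * v) * ?K"
      by (simp add: algebra_simps)
    also have "\<dots> = (LINT t:{R * v..R * w}|lborel. ?K)"
      using R vw by (simp add: set_integral_const)
    also note K_le
    finally have "(w - v) * (c * ?I R) powr (1 / (p - 1)) \<le> (LINT t:{R * v..R * w}|lborel. G t)" .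
    then have "(c * ?I R) powr (1 / (p - 1)) \<le> (LINT t:{R * v..R * w}|lborel. G t) / (w - v)"
      using vw by (simp add: field_simps)
    then have "((c * ?I R) powr (1 / (p - 1))) powr (p - 1) \<le> ((LINT t:{R * v..R * w}|lborel. G t) / (w - v)) powr (p - 1)"
      using p by (intro powr_mono2) auto
    then have "c * ?I R \<le> ((LINT t:{R * v..R * w}|lborel. G t) / (w - v)) powr (p - 1)"
      using p c I0 by (simp add: powr_powr)
    then show ?case using c by (simp add: field_simps)
  qed
  \<comment> \<open>Since \<open>p - 1\<close> is positive and \<open>G\<close> is nonnegative, the
    power preserves convergence to zero.\<close>
  have "((\<lambda>R. ((LINT t:{R * v..R * w}|lborel. G t) / (w - v)) powr (p - 1) / c) \<longlongrightarrow> 0 / c) (radii_to \<zeta>)"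
  proof (intro tendsto_divide tendsto_const)
    show "((\<lambda>R. ((LINT t:{R * v..R * w}|lborel. G t) / (w - v)) powr (p - 1)) \<longlongrightarrow> 0) (radii_to \<zeta>)"
    proof (intro tendsto_zero_powrI[OF _ tendsto_const] tendsto_divide_zero lim always_eventually allI)
      fix R
      have "0 \<le> (LINT t:{R * v..R * w}|lborel. G t)"
        unfolding set_lebesgue_integral_def by (intro integral_nonneg_AE AE_I2) (simp add: G_def)
      then show "0 \<le> (LINT t:{R * v..R * w}|lborel. G t) / (w - v)"
        using vw by simp
    qed (use p in simp)
  qed (use c in auto)
  from tendsto_sandwich[OF _ ev tendsto_const, of 0] this[simplified] show ?thesis
    using eventually_window_integral_nonneg[of g a b \<zeta>] g_pos ab by blast
qed

section \<open>From windows to annuli and test functions\<close>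

text \<open>Polar coordinates produce the weight \<open>s ^ (d - 1)\<close>, which is at most
  \<open>b ^ d / s\<close> on \<open>[a, b]\<close>. The measure \<open>ds / s\<close> is invariant
  under scaling, so substituting \<open>R * s\<close> gives the window integral with no power of
  \<open>R\<close>.\<close>

lemma annulus_integral:
  fixes a b R :: real and g :: "real \<Rightarrow> real"
  assumes ab: "0 < a" "a \<le> b" and R: "0 < R"
    and g_cont: "continuous_on {0<..} g" and g_pos: "\<And>s. 0 < s \<Longrightarrow> 0 < g s"
  shows "integrable lborel (\<lambda>x::'a::euclidean_space. indicator {a..b} (norm x) * g (R * norm x))"
    and "(LINT x|lborel. indicator {a..b} (norm (x :: 'a)) * g (R * norm x)) \<le>
      unit_ball_vol DIM('a) * DIM('a) * b ^ DIM('a) * (LINT s:{R * a..R * b}|lborel. g s / s)"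
proof -
  let ?f = "\<lambda>s. indicator {a..b} s *\<^sub>R g (R * s)"
  let ?D = "DIM('a)"
  have pos: "0 < R * s" if "s \<in> {a..b}" for s
    using that ab R by auto
  have cont: "continuous_on {a..b} (\<lambda>s. g (R * s))"
    using pos by (intro continuous_on_compose2[OF g_cont] continuous_intros) auto
  \<comment> \<open>\<open>g\<close> is controlled only on the positive half-line; the cut-off makes
    the radial profile Borel on the whole line.\<close>
  have [measurable]: "?f \<in> borel_measurable borel"
    by (rule borel_measurable_continuous_on_indicator[OF _ cont]) simp
  have restrict: "indicator {0..} s *\<^sub>R (s ^ (?D - 1) * ?f s) =
      indicator {a..b} s *\<^sub>R (s ^ (?D - 1) * g (R * s))" for s
    using ab by (auto split: split_indicator)
  have int: "set_integrable lborel {a..b} (\<lambda>s. s ^ (?D - 1) * g (R * s))"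
    by (intro borel_integrable_atLeastAtMost' continuous_intros cont)
  have "integrable lborel (\<lambda>x::'a. ?f (norm x))"
    unfolding integral_norm_lborel(2)[OF \<open>?f \<in> _\<close>] set_integrable_def restrict
    using int unfolding set_integrable_def .
  then show "integrable lborel (\<lambda>x::'a. indicator {a..b} (norm x) * g (R * norm x))"
    by simp
  have "(LINT x|lborel. ?f (norm (x :: 'a))) =
      unit_ball_vol ?D * ?D * (LINT s:{a..b}|lborel. s ^ (?D - 1) * g (R * s))"
    unfolding integral_norm_lborel(1)[OF \<open>?f \<in> _\<close>] set_lebesgue_integral_def restrict ..
  also have "\<dots> \<le> unit_ball_vol ?D * ?D * (LINT s:{a..b}|lborel. b ^ ?D * (g (R * s) / s))"
  proof (intro mult_left_mono set_integral_mono int)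
    show "set_integrable lborel {a..b} (\<lambda>s. b ^ ?D * (g (R * s) / s))"
      using ab by (intro borel_integrable_atLeastAtMost' continuous_intros cont) auto
    fix s assume s: "s \<in> {a..b}"
    then have "0 < s" "0 < g (R * s)" using ab R g_pos by auto
    have "s ^ (?D - 1) * g (R * s) = s ^ ?D * (g (R * s) / s)"
      using \<open>0 < s\<close> power_minus_mult[of ?D s] by (simp add: field_simps)
    also have "\<dots> \<le> b ^ ?D * (g (R * s) / s)"
      using s \<open>0 < s\<close> \<open>0 < g (R * s)\<close> by (intro mult_right_mono power_mono) auto
    finally show "s ^ (?D - 1) * g (R * s) \<le> b ^ ?D * (g (R * s) / s)" .
  qed simp
  also have "(LINT s:{a..b}|lborel. b ^ ?D * (g (R * s) / s)) = b ^ ?D * (LINT s:{a..b}|lborel. g (R * s) / s)"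
    by (rule set_integral_mult_right)
  also have "(LINT s:{a..b}|lborel. g (R * s) / s) = (LINT s:{R * a..R * b}|lborel. g s / s)"
    unfolding set_lebesgue_integral_def
    using R by (subst (2) lborel_integral_real_affine[of R _ 0])
      (auto simp flip: Bochner_Integration.integral_mult_right_zero intro!: Bochner_Integration.integral_cong split: split_indicator)
  finally show "(LINT x|lborel. indicator {a..b} (norm (x :: 'a)) * g (R * norm x)) \<le>
      unit_ball_vol DIM('a) * DIM('a) * b ^ DIM('a) * (LINT s:{R * a..R * b}|lborel. g s / s)"
    by (simp add: ac_simps)
qed

text \<open>At each point the indicator vanishes as soon as \<open>k\<close> exceeds the finite
  value \<open>\<bar>\<phi> x\<bar>\<close>; \<open>\<bar>\<phi>\<bar>\<close> dominates.\<close>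

lemma tail_integral_tendsto_0:
  fixes \<phi> :: "'a \<Rightarrow> real"
  assumes "integrable M \<phi>"
  shows "(\<lambda>k. LINT x|M. \<bar>\<phi> x\<bar> * indicator {real k<..} \<bar>\<phi> x\<bar>) \<longlonglongrightarrow> 0"
proof -
  have [measurable]: "\<phi> \<in> borel_measurable M" using assms by simp
  have "(\<lambda>k. LINT x|M. \<bar>\<phi> x\<bar> * indicator {real k<..} \<bar>\<phi> x\<bar>) \<longlonglongrightarrow> (LINT x|M. 0)"
  proof (rule integral_dominated_convergence[where w = "\<lambda>x. \<bar>\<phi> x\<bar>"])
    show "AE x in M. (\<lambda>k. \<bar>\<phi> x\<bar> * indicator {real k<..} \<bar>\<phi> x\<bar>) \<longlonglongrightarrow> 0"
    proof (rule AE_I2)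
      fix x
      have "\<forall>\<^sub>F k in sequentially. \<bar>\<phi> x\<bar> \<le> real k"
        using eventually_ge_at_top[of "nat \<lceil>\<bar>\<phi> x\<bar>\<rceil>"] by eventually_elim linarith
      then show "(\<lambda>k. \<bar>\<phi> x\<bar> * indicator {real k<..} \<bar>\<phi> x\<bar>) \<longlonglongrightarrow> 0"
        by (rule tendsto_eventually[OF eventually_mono]) (auto split: split_indicator)
    qed
  qed (use assms in \<open>auto split: split_indicator\<close>)
  then show ?thesis by simp
qed

text \<open>If \<open>f\<close> is not integrable, its integral is \<open>0\<close> by convention,
  while \<open>h\<close> is nonnegative almost everywhere. A pointwise bound on
  \<open>dilate p V R\<close> times a test function therefore suffices to estimate its
  integral.\<close>

lemma abs_integral_le_of_AE_bound:
  fixes f h :: "'a \<Rightarrow> real"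
  assumes "integrable M h" "AE x in M. \<bar>f x\<bar> \<le> h x"
  shows "\<bar>LINT x|M. f x\<bar> \<le> (LINT x|M. h x)"
proof (cases "integrable M f")
  case True
  then show ?thesis
    using integral_abs_bound[of M f] integral_mono_AE[OF integrable_abs[OF True] assms] by linarith
next
  case False
  have "0 \<le> (LINT x|M. h x)"
    by (rule integral_nonneg_AE) (use assms(2) in eventually_elim, linarith)
  then show ?thesis using False by (simp add: not_integrable_integral_eq)
qed

lemma compact_subset_annulus:
  fixes K :: "'a::euclidean_space set"
  assumes "compact K" "0 \<notin> K"
  obtains a b where "0 < a" "a \<le> b" "\<And>x. x \<in> K \<Longrightarrow> norm x \<in> {a..b}"
proof -
  obtain a where a: "0 < a" "\<And>x. x \<in> K \<Longrightarrow> a \<le> norm x"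
    using separate_point_closed[of K 0] assms compact_imp_closed by (auto simp: dist_norm)
  obtain b where "\<And>x. x \<in> K \<Longrightarrow> norm x \<le> b"
    using assms compact_imp_bounded bounded_iff by metis
  \<comment> \<open>\<open>max a b\<close> keeps the radii ordered even for empty
    \<open>K\<close>.\<close>
  with a show ?thesis by (intro that[of a "max a b"]) force+
qed

text \<open>The factor \<open>R powr p\<close> cancels against the homogeneous denominator
  \<open>(R * norm x) powr p\<close>; the remaining \<open>norm x powr (- p)\<close> is largest on
  the inner sphere of the annulus.\<close>

lemma abs_dilate_le:
  fixes V :: "'a::euclidean_space \<Rightarrow> real"
  assumes \<zeta>: "\<zeta> \<in> {0, \<infinity>}" and ab: "0 < a" "a \<le> b" and p: "0 \<le> p"
    and g: "\<And>s. 0 < s \<Longrightarrow> 0 < g s"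
    and V: "ae_near \<zeta> (\<lambda>x. \<bar>V x\<bar> \<le> g (norm x) / norm x powr p)"
  shows "\<forall>\<^sub>F R in radii_to \<zeta>. AE x in lebesgue. norm x \<in> {a..b} \<longrightarrow>
    \<bar>dilate p V R x\<bar> \<le> a powr (- p) * g (R * norm x)"
proof -
  obtain r where r: "0 < r" and AE: "AE x in lebesgue.
      (if \<zeta> = 0 then 0 < norm x \<and> norm x < r else r < norm x) \<longrightarrow> \<bar>V x\<bar> \<le> g (norm x) / norm x powr p"
    using V unfolding ae_near_def by blast
  from eventually_radii_to_window[OF \<zeta> ab r] show ?thesis
  proof eventually_elim
    case (elim R)
    then have R: "0 < R" by simp
    have norm: "norm (R *\<^sub>R x) = R * norm x" for x :: 'a using R by simp
    \<comment> \<open>The exceptional null set is rescaled with \<open>R\<close>, which is why the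
      almost-everywhere claim stands inside the eventual one.\<close>
    from AE_lebesgue_scaleR[OF AE, of R, unfolded norm] R have "AE x in lebesgue.
      (if \<zeta> = 0 then 0 < R * norm x \<and> R * norm x < r else r < R * norm x) \<longrightarrow>
      \<bar>V (R *\<^sub>R x)\<bar> \<le> g (R * norm x) / (R * norm x) powr p"
      by blast
    then show ?case
    proof (eventually_elim, intro impI)
      fix x :: 'a
      assume bound: "(if \<zeta> = 0 then 0 < R * norm x \<and> R * norm x < r else r < R * norm x) \<longrightarrow>
          \<bar>V (R *\<^sub>R x)\<bar> \<le> g (R * norm x) / (R * norm x) powr p"
        and x: "norm x \<in> {a..b}"
      have "0 < norm x" using x ab by auto
      then have pos: "0 < R * norm x" using R by simp
      have "R * a \<le> R * norm x" "R * norm x \<le> R * b" using x R by auto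
      then have "\<bar>V (R *\<^sub>R x)\<bar> \<le> g (R * norm x) / (R * norm x) powr p"
        using bound elim pos by (smt (verit))
      then have "\<bar>dilate p V R x\<bar> \<le> R powr p * (g (R * norm x) / (R * norm x) powr p)"
        unfolding dilate_def abs_mult by (simp add: mult_left_mono del: times_divide_eq_right)
      also have "\<dots> = norm x powr (- p) * g (R * norm x)"
        using R \<open>0 < norm x\<close> by (simp add: powr_mult powr_minus field_simps)
      also have "\<dots> \<le> a powr (- p) * g (R * norm x)"
        using x ab p g[OF pos] by (intro mult_right_mono powr_mono2') auto
      finally show "\<bar>dilate p V R x\<bar> \<le> a powr (- p) * g (R * norm x)" .
    qed
  qed
qed

text \<open>Passes from the continuous parameter \<open>R\<close> to the sequences used in limiting
  dilated potentials.\<close>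

lemma weak_star_loc_compose:
  fixes U :: "'i \<Rightarrow> 'a::euclidean_space \<Rightarrow> real"
  assumes "weak_star_loc U W F" "filterlim X F G"
  shows "weak_star_loc (\<lambda>n. U (X n)) W G"
  unfolding weak_star_loc_def
proof (intro conjI allI impI)
  fix \<phi> :: "'a \<Rightarrow> real" and K :: "'a set"
  assume "integrable lebesgue \<phi> \<and> compact K \<and> 0 \<notin> K \<and> (\<forall>x. x \<notin> K \<longrightarrow> \<phi> x = 0)"
  with assms(1) have "((\<lambda>i. LINT x|lebesgue. U i x * \<phi> x) \<longlongrightarrow> (LINT x|lebesgue. W x * \<phi> x)) F"
    unfolding weak_star_loc_def by blast
  then show "((\<lambda>n. LINT x|lebesgue. U (X n) x * \<phi> x) \<longlongrightarrow> (LINT x|lebesgue. W x * \<phi> x)) G"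
    using assms(2) by (rule filterlim_compose)
qed (use assms(1) in \<open>simp add: weak_star_loc_def\<close>)

text \<open>The test function is split at height \<open>k\<close>. Its bounded part is paired with
  the annulus integral of \<open>g (R * norm x)\<close>, which vanishes as \<open>R\<close> tends to
  \<zeta>; on the rest \<open>g\<close> is bounded by \<open>M\<close>, leaving a tail of an
  integrable function, uniformly in \<open>R\<close>.\<close>

lemma dilate_weak_star_tendsto_0:
  fixes V :: "'a::euclidean_space \<Rightarrow> real"
  assumes \<zeta>: "\<zeta> \<in> {0, \<infinity>}" and p: "0 \<le> p"
    and g_cont: "continuous_on {0<..} g" and g_pos: "\<And>s. 0 < s \<Longrightarrow> 0 < g s"
    and g_bdd: "\<And>s. 0 < s \<Longrightarrow> g s \<le> M"
    and V: "ae_near \<zeta> (\<lambda>x. \<bar>V x\<bar> \<le> g (norm x) / norm x powr p)"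
    and lim: "\<And>a b. 0 < a \<Longrightarrow> a \<le> b \<Longrightarrow>
      ((\<lambda>R. LINT s:{R * a..R * b}|lborel. g s / s) \<longlongrightarrow> 0) (radii_to \<zeta>)"
  shows "weak_star_loc (dilate p V) (\<lambda>x. 0) (radii_to \<zeta>)"
proof -
  have "((\<lambda>R. LINT x|lebesgue. dilate p V R x * \<phi> x) \<longlongrightarrow> 0) (radii_to \<zeta>)"
    if \<phi>: "integrable lebesgue \<phi>" and K: "compact K" "0 \<notin> K" and supp: "\<And>x. x \<notin> K \<Longrightarrow> \<phi> x = 0"
    for \<phi> :: "'a \<Rightarrow> real" and K
  proof -
    obtain a b where ab: "0 < a" "a \<le> b" and Kab: "\<And>x. x \<in> K \<Longrightarrow> norm x \<in> {a..b}"
      using compact_subset_annulus[OF K] by metis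
    have [measurable]: "\<phi> \<in> borel_measurable lebesgue" using \<phi> by simp
    define T where "T k = (LINT x|lebesgue. \<bar>\<phi> x\<bar> * indicator {real k<..} \<bar>\<phi> x\<bar>)" for k
    define C where "C = unit_ball_vol DIM('a) * DIM('a) * b ^ DIM('a)"
    let ?I = "\<lambda>R. LINT s:{R * a..R * b}|lborel. g s / s"
    have dil_le: "\<forall>\<^sub>F R in radii_to \<zeta>. AE x in lebesgue. norm x \<in> {a..b} \<longrightarrow>
        \<bar>dilate p V R x\<bar> \<le> a powr (- p) * g (R * norm x)"
      by (rule abs_dilate_le[OF \<zeta> ab p _ V]) (rule g_pos)
    have bound: "\<forall>\<^sub>F R in radii_to \<zeta>. \<bar>LINT x|lebesgue. dilate p V R x * \<phi> x\<bar> \<le>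
        a powr (- p) * (real k * (C * ?I R) + M * T k)" for k
      using dil_le eventually_radii_to_pos
    proof eventually_elim
      case (elim R)
      let ?G = "\<lambda>x::'a. indicator {a..b} (norm x) * g (R * norm x)"
      let ?t = "\<lambda>x. \<bar>\<phi> x\<bar> * indicator {real k<..} \<bar>\<phi> x\<bar>"
      have G: "integrable lebesgue ?G" "(LINT x|lebesgue. ?G x) \<le> C * ?I R"
        using annulus_integral[where 'a = 'a, OF ab elim(2) g_cont] g_pos
        by (simp_all add: C_def integrable_completion integral_completion)
      have t: "integrable lebesgue ?t"
        by (rule Bochner_Integration.integrable_bound[OF \<phi>]) (auto split: split_indicator)
      have "\<bar>LINT x|lebesgue. dilate p V R x * \<phi> x\<bar> \<le>
          (LINT x|lebesgue. a powr (- p) * (real k * ?G x + M * ?t x))"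
      proof (rule abs_integral_le_of_AE_bound)
        show "integrable lebesgue (\<lambda>x. a powr (- p) * (real k * ?G x + M * ?t x))"
          by (intro integrable_mult_right Bochner_Integration.integrable_add G t)
        from elim(1) show "AE x in lebesgue. \<bar>dilate p V R x * \<phi> x\<bar> \<le> a powr (- p) * (real k * ?G x + M * ?t x)"
        proof eventually_elim
          fix x
          assume dil: "norm x \<in> {a..b} \<longrightarrow> \<bar>dilate p V R x\<bar> \<le> a powr (- p) * g (R * norm x)"
          show "\<bar>dilate p V R x * \<phi> x\<bar> \<le> a powr (- p) * (real k * ?G x + M * ?t x)"
          proof (cases "norm x \<in> {a..b}")
            case False
            then have "\<phi> x = 0" using Kab supp by blast
            with False show ?thesis by simp
          next
            case True
            then have "0 < norm x" using ab by auto
            then have pos: "0 < R * norm x" using elim(2) by simp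
            \<comment> \<open>Below height \<open>k\<close> the first summand suffices and
              \<open>?t\<close> is zero; above it the second one does, by the bound on
              \<open>g\<close>.\<close>
            have "g (R * norm x) * \<bar>\<phi> x\<bar> \<le> real k * g (R * norm x) + M * ?t x"
            proof (cases "\<bar>\<phi> x\<bar> \<le> real k")
              case True
              then show ?thesis using g_pos[OF pos] by (simp add: mult.commute mult_left_mono)
            next
              case False
              then show ?thesis
                using g_pos[OF pos] mult_right_mono[OF g_bdd[OF pos], of "\<bar>\<phi> x\<bar>"]
                by (simp add: add_increasing)
            qed
            then have "a powr (- p) * (g (R * norm x) * \<bar>\<phi> x\<bar>) \<le> a powr (- p) * (real k * ?G x + M * ?t x)"
              using True by (intro mult_left_mono) auto
            moreover have "\<bar>dilate p V R x * \<phi> x\<bar> \<le> a powr (- p) * g (R * norm x) * \<bar>\<phi> x\<bar>"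
              unfolding abs_mult using dil True by (intro mult_right_mono) auto
            ultimately show ?thesis by (simp add: mult.assoc)
          qed
        qed
      qed
      also have "\<dots> = a powr (- p) * (real k * (LINT x|lebesgue. ?G x) + M * T k)"
        unfolding T_def using G t by simp
      also have "\<dots> \<le> a powr (- p) * (real k * (C * ?I R) + M * T k)"
        using G(2) by (intro mult_left_mono add_right_mono) auto
      finally show ?case .
    qed
    show ?thesis
    proof (rule tendstoI)
      fix \<epsilon> :: real assume "0 < \<epsilon>"
      \<comment> \<open>The order of choices matters: \<open>T k\<close> does not depend on
        \<open>R\<close>, so \<open>k\<close> is fixed first, and only then does \<open>R\<close>
        tend to \<zeta>.\<close>
      have "(\<lambda>k. a powr (- p) * (M * T k)) \<longlonglongrightarrow> a powr (- p) * (M * 0)"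
        unfolding T_def by (intro tendsto_intros tail_integral_tendsto_0 \<phi>)
      then have "\<forall>\<^sub>F k in sequentially. a powr (- p) * (M * T k) < \<epsilon>"
        using \<open>0 < \<epsilon>\<close> by (intro order_tendstoD) auto
      then obtain k where k: "a powr (- p) * (M * T k) < \<epsilon>"
        by (auto simp: eventually_sequentially)
      have "((\<lambda>R. a powr (- p) * (real k * (C * ?I R) + M * T k)) \<longlongrightarrow>
          a powr (- p) * (real k * (C * 0) + M * T k)) (radii_to \<zeta>)"
        by (intro tendsto_intros lim ab)
      then have "\<forall>\<^sub>F R in radii_to \<zeta>. a powr (- p) * (real k * (C * ?I R) + M * T k) < \<epsilon>"
        using k by (intro order_tendstoD) auto
      with bound[of k] show "\<forall>\<^sub>F R in radii_to \<zeta>. dist (LINT x|lebesgue. dilate p V R x * \<phi> x) 0 < \<epsilon>"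
        by eventually_elim simp
    qed
  qed
  then show ?thesis
    unfolding weak_star_loc_def by (auto simp: Linf_loc_def)
qed

section \<open>Weak* vanishing of the dilations and the resulting Fuchsian property\<close>

theorem lemma1p7:
  fixes p R\<^sub>0 :: real and \<zeta> :: ereal and g :: "real \<Rightarrow> real" and V :: "real ^ 'n \<Rightarrow> real"
  assumes "1 < p"
    and "2 \<le> CARD('n)"
    and "\<zeta> \<in> {0, \<infinity>}"
    and "0 < R\<^sub>0"
    and "V \<in> Linf_loc (sing_domain \<zeta> R\<^sub>0 - {0})"
    and "continuous_on {0<..} g"
    and "\<And>s. 0 < s \<Longrightarrow> 0 < g s"
    and "bounded (g ` {0<..})"
    and "ae_near \<zeta> (\<lambda>x. \<bar>V x\<bar> \<le> g (norm x) / norm x powr p)"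
    and "nested_integral_condition p CARD('n) \<zeta> g \<or> simple_integral_condition p CARD('n) \<zeta> g"
  shows "weak_fuchsian p \<zeta> V \<and> weak_star_loc (dilate p V) (\<lambda>x. 0) (radii_to \<zeta>)"
proof
  note g_cont = assms(6) and g_pos = assms(7)
  obtain M where M: "\<And>s. 0 < s \<Longrightarrow> \<bar>g s\<bar> \<le> M"
    using assms(8) by (auto simp: bounded_iff)
  have "((\<lambda>R. LINT s:{R * a..R * b}|lborel. g s / s) \<longlongrightarrow> 0) (radii_to \<zeta>)"
    if "0 < a" "a \<le> b" for a b
    using assms(10)
  proof
    assume "nested_integral_condition p CARD('n) \<zeta> g"
    with assms(1,2) show ?thesis
      by (intro nested_condition_imp_window_integral_tendsto_0[OF assms(3) that g_cont g_pos]) auto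
  next
    assume "simple_integral_condition p CARD('n) \<zeta> g"
    then show ?thesis
      by (intro simple_condition_imp_window_integral_tendsto_0[OF assms(3) that g_cont g_pos])
  qed
  then show lim: "weak_star_loc (dilate p V) (\<lambda>x. 0) (radii_to \<zeta>)"
    using assms(1) by (intro dilate_weak_star_tendsto_0[OF assms(3) _ g_cont g_pos abs_le_D1[OF M] assms(9)]) auto
  show "weak_fuchsian p \<zeta> V"
    unfolding weak_fuchsian_def
  proof
    obtain r where r: "0 < r" and AE: "AE x in lebesgue.
        (if \<zeta> = 0 then 0 < norm x \<and> norm x < r else r < norm x) \<longrightarrow> \<bar>V x\<bar> \<le> g (norm x) / norm x powr p"
      using assms(9) unfolding ae_near_def by blast
    \<comment> \<open>The bound of \<open>g\<close> serves as the Fuchsian constant; its positivity,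
      demanded by the definition, comes from \<open>g 1\<close>.\<close>
    have M0: "0 < M" using M[of 1] g_pos[of 1] by simp
    have le_M: "norm x powr p * \<bar>V x\<bar> \<le> M" if "0 < norm x" "\<bar>V x\<bar> \<le> g (norm x) / norm x powr p" for x
    proof -
      have "norm x powr p * \<bar>V x\<bar> \<le> g (norm x)"
        using that by (simp add: field_simps)
      then show ?thesis using M[OF that(1)] by linarith
    qed
    have "ae_near \<zeta> (\<lambda>x. norm x powr p * \<bar>V x\<bar> \<le> M)"
      unfolding ae_near_def using r
      by (intro exI[of _ r] conjI eventually_mono[OF AE]) (auto simp del: zero_less_norm_iff intro!: le_M split: if_splits)
    with M0 show "\<exists>C>0. ae_near \<zeta> (\<lambda>x. norm x powr p * \<bar>V x\<bar> \<le> C)" by blast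
  next
    \<comment> \<open>A concrete sequence tending to \<zeta>; \<open>Suc\<close> keeps every term
      positive, including the one at \<open>n = 0\<close>.\<close>
    define \<rho> :: "nat \<Rightarrow> real" where "\<rho> n = (if \<zeta> = 0 then inverse (real (Suc n)) else real (Suc n))" for n
    have pos: "0 < \<rho> n" for n by (simp add: \<rho>_def)
    have "filterlim \<rho> (radii_to \<zeta>) sequentially"
    proof (cases "\<zeta> = 0")
      case True
      then have "\<rho> = (\<lambda>n. inverse (real (Suc n)))" by (simp add: \<rho>_def fun_eq_iff)
      with True show ?thesis
        using LIMSEQ_inverse_real_of_nat pos by (simp add: radii_to_def filterlim_at_right_to_0 filterlim_at)
    next
      case False
      then have "\<rho> = (\<lambda>n. real (Suc n))" by (simp add: \<rho>_def fun_eq_iff)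
      with False show ?thesis
        using filterlim_compose[OF filterlim_real_sequentially filterlim_Suc] by (simp add: radii_to_def)
    qed
    moreover from this have "limiting_dilated_potential p V \<rho> (\<lambda>x. 0)"
      unfolding limiting_dilated_potential_def by (rule weak_star_loc_compose[OF lim])
    \<comment> \<open>One step \<open>m = 1\<close> is enough, with \<open>W 0 = V\<close> and
      \<open>W 1 = 0\<close>; the index range \<open>{2..m}\<close> is then empty.\<close>
    ultimately show "\<exists>(m::nat) Z R W. 1 \<le> m \<and> Z 1 = \<zeta> \<and> (\<forall>i\<in>{2..m}. Z i \<in> {0, \<infinity>}) \<and>
        (\<forall>i\<in>{1..m}. (\<forall>n. 0 < R i n) \<and> filterlim (R i) (radii_to (Z i)) sequentially) \<and>
        W 0 = V \<and>
        (\<forall>i\<in>{1..m}. limiting_dilated_potential p (W (i - 1)) (R i) (W i)) \<and>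
        (AE x in lebesgue. W m x = 0)"
      using pos \<open>\<zeta> \<in> _\<close>
      by (intro exI[of _ "1::nat"] exI[of _ "\<lambda>_. \<zeta>"] exI[of _ "\<lambda>_. \<rho>"]
        exI[of _ "\<lambda>i::nat. if i = 0 then V else (\<lambda>x. 0)"]) simp
  qed
qed

end
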